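(* For each $\epsilon > 0$ there exists a positive constant $C = C(\epsilon)$ such that for any generalised Petersen graph $P(n,k)$ (with $n \geq 3$ and $1 \leq k \leq n/2$ integers), the number of eigenvalues $\lambda_i$ of $P(n,k)$, counted with multiplicity, such that $\lambda_i \geq 3 - \epsilon$ is at least $C \cdot 2n$.
   Context: For positive integers $n \geq 3$ and $k \leq n/2$, the generalised Petersen graph $P(n,k)$ is the graph with vertex set $\{a_i, b_i : 0 \leq i \leq n-1\}$ (so $2n$ vertices) and edges $a_i a_{i+1}$, $a_i b_i$, $b_i b_{i+k}$ for $0 \leq i \leq n-1$, with subscripts read modulo $n$. When $k=n/2$, the edges $b_ib_{i+k}$ and $b_{i+k}b_{i+2k}=b_{i+k}b_i$ are counted separately, so that $b_i$ and $b_{i+k}$ are joined by a double edge (adjacency matrix entry $2$). With this convention $P(n,k)$ is always connected and cubic ($3$-regular). The eigenvalues of a graph are the eigenvalues of its adjacency matrix. *)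

theory Defs
  imports Complex_Main "Jordan_Normal_Form.Char_Poly"
begin

text \<open>
  The generalised Petersen graph is a multigraph whose edges carry labels, so that
  for \<open>2 * k = n\<close> the edges \<open>Inner i\<close> and \<open>Inner (i + k)\<close> are distinct although they
  have the same ends; this yields the double edges required by the convention.
\<close>

datatype gp_vertex = VtxA nat | VtxB nat

datatype gp_edge = Outer nat | Spoke nat | Inner nat

definition gp_verts :: "nat \<Rightarrow> gp_vertex set" where
  "gp_verts n = VtxA ` {..<n} \<union> VtxB ` {..<n}"

definition gp_edges :: "nat \<Rightarrow> gp_edge set" where
  "gp_edges n = Outer ` {..<n} \<union> Spoke ` {..<n} \<union> Inner ` {..<n}"

fun gp_ends :: "nat \<Rightarrow> nat \<Rightarrow> gp_edge \<Rightarrow> gp_vertex set" where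
  "gp_ends n k (Outer i) = {VtxA i, VtxA ((i + 1) mod n)}"
| "gp_ends n k (Spoke i) = {VtxA i, VtxB i}"
| "gp_ends n k (Inner i) = {VtxB i, VtxB ((i + k) mod n)}"

definition gp_mult :: "nat \<Rightarrow> nat \<Rightarrow> gp_vertex \<Rightarrow> gp_vertex \<Rightarrow> nat" where
  "gp_mult n k u v = card {e \<in> gp_edges n. gp_ends n k e = {u, v}}"

text \<open>Vertices are enumerated as \<open>VtxA 0, \<dots>, VtxA (n - 1), VtxB 0, \<dots>, VtxB (n - 1)\<close>.\<close>

definition gp_vertex_at :: "nat \<Rightarrow> nat \<Rightarrow> gp_vertex" where
  "gp_vertex_at n p = (if p < n then VtxA p else VtxB (p - n))"

lemma bij_betw_gp_vertex_at: "bij_betw (gp_vertex_at n) {..<2 * n} (gp_verts n)"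
proof (rule bij_betw_byWitness[where f' = "\<lambda>v. case v of VtxA i \<Rightarrow> i | VtxB i \<Rightarrow> n + i"])
qed (auto simp: gp_vertex_at_def gp_verts_def)

definition gp_adj_mat :: "nat \<Rightarrow> nat \<Rightarrow> real mat" where
  "gp_adj_mat n k =
     mat (2 * n) (2 * n) (\<lambda>(p, q). real (gp_mult n k (gp_vertex_at n p) (gp_vertex_at n q)))"

text \<open>
  Multiplicity is algebraic. For the real symmetric matrices considered here all complex
  eigenvalues are real, so restricting to real eigenvalues loses nothing.
\<close>

definition num_eigenvalues_ge :: "real mat \<Rightarrow> real \<Rightarrow> nat" where
  "num_eigenvalues_ge M t = (\<Sum>x | eigenvalue M x \<and> t \<le> x. order x (char_poly M))"

end

theory Submission imports Defs "HOL-Library.FuncSet" begin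

text \<open>
  The adjacency matrix has four circulant blocks, so the discrete Fourier transform splits it into
  the \<open>2 \<times> 2\<close> matrices with diagonal entries \<open>2 cos \<theta>\<close>, \<open>2 cos k\<theta>\<close> and off-diagonal entries \<open>1\<close>,
  one for each \<open>\<theta> = 2\<pi>j/n\<close>. The larger eigenvalue of such a matrix is at least
  \<open>1 + cos \<theta> + cos k\<theta>\<close>. Dividing the torus of pairs of angles into \<open>m\<^sup>2\<close> cells, some cell
  contains \<open>(\<theta>, k\<theta>)\<close> for at least \<open>n / m\<^sup>2\<close> indices \<open>j\<close>; their differences from a fixed one
  among them make both angles small, where the number of cells depends only on \<open>\<epsilon>\<close>.
\<close>

section \<open>Edge multiplicities and the block form of the adjacency matrix\<close>

lemma card_cyclic_shift_edges:
  fixes i l n s :: nat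
  assumes "0 < s" "s < n" "i < n" "l < n"
  shows "card {m \<in> {..<n}. {m, (m + s) mod n} = {i, l}} =
    of_bool (l = (i + s) mod n) + of_bool (i = (l + s) mod n)"
proof (cases "i = l")
  case True
  have "(m + s) mod n \<noteq> m" if "m < n" for m
  proof (cases "m + s < n")
    case False
    then have "(m + s) mod n = m + s - n"
      using assms that by (subst mod_if) simp
    then show ?thesis using assms that False by linarith
  qed (use assms in simp)
  then have "{m \<in> {..<n}. {m, (m + s) mod n} = {i, l}} = {}" "(i + s) mod n \<noteq> i"
    using True assms by auto
  then show ?thesis using True by simp
next
  case False
  \<comment> \<open>A shift edge with ends \<open>i\<close> and \<open>l\<close> starts at
    \<open>i\<close> (case \<open>P\<close>) or at \<open>l\<close> (case \<open>Q\<close>). As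
    \<open>i\<close> and \<open>l\<close> differ, these are two edges when both cases hold; that
    forces \<open>2 * s = n\<close> and is the double edge.\<close>
  define P where "P \<longleftrightarrow> l = (i + s) mod n"
  define Q where "Q \<longleftrightarrow> i = (l + s) mod n"
  have "{m \<in> {..<n}. {m, (m + s) mod n} = {i, l}} =
      (if P then {i} else {}) \<union> (if Q then {l} else {})"
    using assms(3,4) by (auto simp: P_def Q_def doubleton_eq_iff)
  also have "card \<dots> = of_bool P + of_bool Q"
    using False by simp
  finally show ?thesis by (simp only: P_def Q_def)
qed

lemma gp_mult_outer:
  assumes "3 \<le> n" "i < n" "l < n"
  shows "gp_mult n k (VtxA i) (VtxA l) =
    of_bool (l = (i + 1) mod n) + of_bool (i = (l + 1) mod n)"
proof -
  have "gp_ends n k (Outer m) = {VtxA i, VtxA l} \<longleftrightarrow> {m, (m + 1) mod n} = {i, l}"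
    "gp_ends n k (Inner m) \<noteq> {VtxA i, VtxA l}" "gp_ends n k (Spoke m) \<noteq> {VtxA i, VtxA l}" for m
    by (simp_all add: doubleton_eq_iff)
  then have "{e \<in> gp_edges n. gp_ends n k e = {VtxA i, VtxA l}} =
      Outer ` {m \<in> {..<n}. {m, (m + 1) mod n} = {i, l}}"
    unfolding gp_edges_def by blast
  then show ?thesis
    unfolding gp_mult_def using card_cyclic_shift_edges[of 1 n i l] assms
    by (simp add: card_image inj_on_def)
qed

lemma gp_mult_inner:
  assumes "0 < k" "k < n" "i < n" "l < n"
  shows "gp_mult n k (VtxB i) (VtxB l) =
    of_bool (l = (i + k) mod n) + of_bool (i = (l + k) mod n)"
proof -
  have "gp_ends n k (Inner m) = {VtxB i, VtxB l} \<longleftrightarrow> {m, (m + k) mod n} = {i, l}"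
    "gp_ends n k (Outer m) \<noteq> {VtxB i, VtxB l}" "gp_ends n k (Spoke m) \<noteq> {VtxB i, VtxB l}" for m
    by (simp_all add: doubleton_eq_iff)
  then have "{e \<in> gp_edges n. gp_ends n k e = {VtxB i, VtxB l}} =
      Inner ` {m \<in> {..<n}. {m, (m + k) mod n} = {i, l}}"
    unfolding gp_edges_def by blast
  then show ?thesis
    unfolding gp_mult_def using card_cyclic_shift_edges[of k n i l] assms
    by (simp add: card_image inj_on_def)
qed

lemma gp_mult_spoke:
  assumes "i < n" "l < n"
  shows "gp_mult n k (VtxA i) (VtxB l) = of_bool (i = l)"
    and "gp_mult n k (VtxB l) (VtxA i) = of_bool (i = l)"
proof -
  have "gp_ends n k (Spoke m) = {VtxA i, VtxB l} \<longleftrightarrow> m = i \<and> m = l"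
    "gp_ends n k (Outer m) \<noteq> {VtxA i, VtxB l}" "gp_ends n k (Inner m) \<noteq> {VtxA i, VtxB l}" for m
    by (auto simp: doubleton_eq_iff)
  then have "{e \<in> gp_edges n. gp_ends n k e = {VtxA i, VtxB l}} = (if i = l then {Spoke i} else {})"
    using assms(1) by (auto simp: gp_edges_def simp del: gp_ends.simps)
  then show AB: "gp_mult n k (VtxA i) (VtxB l) = of_bool (i = l)"
    by (simp add: gp_mult_def)
  show "gp_mult n k (VtxB l) (VtxA i) = of_bool (i = l)"
    using AB by (simp only: gp_mult_def insert_commute[of "VtxB l"])
qed

text \<open>A sum of two indicators rather than one disjunction, so that coinciding shifts by
  \<open>s\<close> and \<open>- s\<close>, as for \<open>2 * s = n\<close>, give the entry 2. The
  entries are complex because the Fourier matrix will act on them.\<close>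

definition circulant :: "nat \<Rightarrow> nat \<Rightarrow> complex mat" where
  "circulant n s =
     mat n n (\<lambda>(i, l). of_bool (l = (i + s) mod n) + of_bool (i = (l + s) mod n))"

lemma circulant_carrier [simp]: "circulant n s \<in> carrier_mat n n"
  by (simp add: circulant_def)

lemma gp_adj_mat_four_block:
  assumes "3 \<le> n" "1 \<le> k" "2 * k \<le> n"
  shows "map_mat of_real (gp_adj_mat n k) =
    four_block_mat (circulant n 1) (1\<^sub>m n) (1\<^sub>m n) (circulant n k)"
proof (rule eq_matI)
  fix p q
  assume "p < dim_row (four_block_mat (circulant n 1) (1\<^sub>m n) (1\<^sub>m n) (circulant n k))"
    and "q < dim_col (four_block_mat (circulant n 1) (1\<^sub>m n) (1\<^sub>m n) (circulant n k))"
  then have "p < 2 * n" "q < 2 * n" by (auto simp: circulant_def)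
  then show "map_mat of_real (gp_adj_mat n k) $$ (p, q) =
      four_block_mat (circulant n 1) (1\<^sub>m n) (1\<^sub>m n) (circulant n k) $$ (p, q)"
    using assms
    by (cases "p < n"; cases "q < n")
      (auto simp: gp_adj_mat_def gp_vertex_at_def gp_mult_outer gp_mult_inner gp_mult_spoke circulant_def)
qed (auto simp: gp_adj_mat_def circulant_def)

section \<open>Roots of unity and the discrete Fourier transform\<close>

definition unity_root :: "nat \<Rightarrow> int \<Rightarrow> complex" where
  "unity_root n m = cis (2 * pi * of_int m / of_nat n)"

lemma unity_root_add: "unity_root n (a + b) = unity_root n a * unity_root n b"
  by (simp add: unity_root_def cis_mult add_divide_distrib distrib_left)

lemma unity_root_0 [simp]: "unity_root n 0 = 1"
  by (simp add: unity_root_def)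

lemma unity_root_power: "unity_root n a ^ l = unity_root n (int l * a)"
  by (simp add: unity_root_def DeMoivre mult_ac)

lemma unity_root_mult_self: "0 < n \<Longrightarrow> unity_root n (int n * a) = 1"
  using cis_multiple_2pi[of "of_int a"] by (simp add: unity_root_def mult_ac)

text \<open>Serves to drop the reduction modulo \<open>n\<close> from row indices shifted by a
  circulant; integer exponents cover the shift by \<open>- s\<close> as well.\<close>

lemma unity_root_cong:
  assumes "0 < n" "a mod int n = b mod int n"
  shows "unity_root n a = unity_root n b"
proof -
  have "int n dvd a - b" using assms(2) by (simp add: mod_eq_dvd_iff)
  then obtain c where "a - b = int n * c" ..
  then have "a = b + int n * c" by simp
  then show ?thesis using assms by (simp add: unity_root_add unity_root_mult_self)
qed

lemma unity_root_add_uminus: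
  "unity_root n a + unity_root n (- a) = of_real (2 * cos (2 * pi * of_int a / of_nat n))"
  by (simp add: unity_root_def complex_eq_iff)

text \<open>Orthogonality of characters. For distinct \<open>i\<close> and \<open>j\<close> the sum
  is geometric, with a ratio that is an \<open>n\<close>-th root of unity and differs from 1 because
  \<open>i\<close> and \<open>j\<close> index different roots.\<close>

lemma sum_unity_root:
  assumes "i < n" "j < n"
  shows "(\<Sum>l<n. unity_root n (int l * (int i - int j))) = (if i = j then of_nat n else 0)"
proof (cases "i = j")
  case False
  let ?z = "unity_root n (int i - int j)"
  have n: "0 < n" using assms by simp
  have "?z \<noteq> 1"
  proof
    assume z: "?z = 1"
    have "unity_root n (int i) = unity_root n (int j) * ?z"
      by (simp flip: unity_root_add)
    then have "cis (2 * pi * of_nat i / of_nat n) = cis (2 * pi * of_nat j / of_nat n)"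
      using z by (simp add: unity_root_def)
    moreover have "inj_on (\<lambda>k. cis (2 * pi * real k / real n)) {..<n}"
      using bij_betw_roots_unity[OF n] by (rule bij_betw_imp_inj_on)
    ultimately show False using False assms by (auto dest: inj_onD)
  qed
  moreover have "?z ^ n = 1"
    using n by (simp add: unity_root_power unity_root_mult_self)
  ultimately show ?thesis
    using False by (simp add: geometric_sum flip: unity_root_power)
qed simp

definition dft_mat :: "nat \<Rightarrow> complex mat" where
  "dft_mat n = mat n n (\<lambda>(i, j). unity_root n (int i * int j))"

definition idft_mat :: "nat \<Rightarrow> complex mat" where
  "idft_mat n = mat n n (\<lambda>(i, j). unity_root n (- (int i * int j)) / of_nat n)"

lemma dft_mat_carrier [simp]: "dft_mat n \<in> carrier_mat n n" "idft_mat n \<in> carrier_mat n n"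
  by (simp_all add: dft_mat_def idft_mat_def)

lemma dft_mat_inverse:
  shows "dft_mat n * idft_mat n = 1\<^sub>m n" and "idft_mat n * dft_mat n = 1\<^sub>m n"
proof -
  show "dft_mat n * idft_mat n = 1\<^sub>m n"
  proof (rule eq_matI)
    fix i j assume "i < dim_row (1\<^sub>m n :: complex mat)" "j < dim_col (1\<^sub>m n :: complex mat)"
    then have ij: "i < n" "j < n" by auto
    then have "(dft_mat n * idft_mat n) $$ (i, j) =
        (\<Sum>l<n. unity_root n (int l * (int i - int j))) / of_nat n"
      by (auto simp: dft_mat_def idft_mat_def scalar_prod_def sum_divide_distrib atLeast0LessThan
          algebra_simps simp flip: unity_root_add intro!: sum.cong)
    then show "(dft_mat n * idft_mat n) $$ (i, j) = 1\<^sub>m n $$ (i, j)"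
      using ij by (simp add: sum_unity_root)
  qed (auto simp: dft_mat_def idft_mat_def)
  then show "idft_mat n * dft_mat n = 1\<^sub>m n"
    by (rule mat_mult_left_right_inverse[rotated 2]) simp_all
qed

text \<open>Column \<open>j\<close> of the Fourier matrix is an eigenvector of every circulant: the
  shifts by \<open>s\<close> and \<open>- s\<close> multiply it by conjugate roots of unity, whose
  sum is twice a cosine. The same matrix thus diagonalises the blocks for \<open>s = 1\<close> and
  \<open>s = k\<close> at once.\<close>

lemma circulant_mult_dft_mat:
  assumes "s \<le> n"
  shows "circulant n s * dft_mat n =
    dft_mat n * mat_diag n (\<lambda>j. of_real (2 * cos (2 * pi * real (s * j) / real n)))"
proof (rule eq_matI)
  let ?D = "mat_diag n (\<lambda>j. of_real (2 * cos (2 * pi * real (s * j) / real n))) :: complex mat"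
  fix i j assume "i < dim_row (dft_mat n * ?D)" "j < dim_col (dft_mat n * ?D)"
  then have i: "i < n" and j: "j < n" by (auto simp: dft_mat_def mat_diag_def)
  have n: "0 < n" using i by simp
  let ?w = "\<lambda>l. unity_root n (int l * int j)"
  \<comment> \<open>\<open>?v\<close> stands for \<open>i - s\<close> modulo \<open>n\<close>;
    adding \<open>n - s\<close> avoids truncated subtraction.\<close>
  let ?u = "(i + s) mod n" and ?v = "(i + (n - s)) mod n"
  have v: "i = (l + s) mod n \<longleftrightarrow> l = ?v" if "l < n" for l
  proof
    assume "i = (l + s) mod n"
    then have "?v = (l + s + (n - s)) mod n" by (simp add: mod_add_left_eq)
    then show "l = ?v" using that assms by simp
  next
    assume "l = ?v"
    then have "(l + s) mod n = (i + (n - s) + s) mod n" by (simp add: mod_add_left_eq)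
    then show "i = (l + s) mod n" using i assms by simp
  qed
  have "(circulant n s * dft_mat n) $$ (i, j) =
      (\<Sum>l<n. (of_bool (l = ?u) + of_bool (i = (l + s) mod n)) * ?w l)"
    using i j by (auto simp: circulant_def dft_mat_def scalar_prod_def atLeast0LessThan intro!: sum.cong)
  also have "\<dots> = (\<Sum>l<n. (if l = ?u then ?w l else 0) + (if l = ?v then ?w l else 0))"
    by (rule sum.cong) (auto simp: v)
  also have "\<dots> = ?w ?u + ?w ?v"
    using n by (simp add: sum.distrib)
  also have "?w ?u = unity_root n (int i * int j + int (s * j))"
  proof (intro unity_root_cong)
    have "int ?u * int j mod int n = (int i + int s) * int j mod int n"
      by (simp add: zmod_int mod_mult_left_eq)
    then show "int ?u * int j mod int n = (int i * int j + int (s * j)) mod int n"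
      by (simp add: distrib_right)
  qed (use n in simp)
  also have "?w ?v = unity_root n (int i * int j + - int (s * j))"
  proof (intro unity_root_cong)
    have "int ?v * int j mod int n = (int i + (int n - int s)) * int j mod int n"
      using assms by (simp add: zmod_int mod_mult_left_eq of_nat_diff add_diff_eq)
    also have "(int i + (int n - int s)) * int j = int i * int j + - int (s * j) + int n * int j"
      by (simp add: algebra_simps)
    finally show "int ?v * int j mod int n = (int i * int j + - int (s * j)) mod int n"
      by simp
  qed (use n in simp)
  also have "unity_root n (int i * int j + int (s * j)) + unity_root n (int i * int j + - int (s * j)) =
      ?w i * (unity_root n (int (s * j)) + unity_root n (- int (s * j)))"
    by (simp only: unity_root_add distrib_left)
  also have "\<dots> = ?w i * of_real (2 * cos (2 * pi * real (s * j) / real n))"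
    by (simp only: unity_root_add_uminus of_int_of_nat_eq)
  also have "\<dots> = (dft_mat n * ?D) $$ (i, j)"
    using i j by (simp add: mat_diag_mult_right[where nr = n] dft_mat_def)
  finally show "(circulant n s * dft_mat n) $$ (i, j) = (dft_mat n * ?D) $$ (i, j)" .
qed (auto simp: circulant_def dft_mat_def mat_diag_def)

section \<open>Block diagonalisation and the characteristic polynomial\<close>

lemma similar_four_block_conjugate:
  fixes P Q C D C' D' :: "'a :: comm_ring_1 mat"
  assumes carrier: "P \<in> carrier_mat n n" "Q \<in> carrier_mat n n" "C \<in> carrier_mat n n"
      "D \<in> carrier_mat n n" "C' \<in> carrier_mat n n" "D' \<in> carrier_mat n n"
    and PQ: "P * Q = 1\<^sub>m n" and QP: "Q * P = 1\<^sub>m n"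
    and C: "C * P = P * C'" and D: "D * P = P * D'"
  shows "similar_mat (four_block_mat C (1\<^sub>m n) (1\<^sub>m n) D) (four_block_mat C' (1\<^sub>m n) (1\<^sub>m n) D')"
proof -
  let ?Z = "0\<^sub>m n n :: 'a mat" and ?I = "1\<^sub>m n :: 'a mat"
  \<comment> \<open>Using the same \<open>P\<close> in both diagonal positions leaves the
    off-diagonal identity blocks unchanged under conjugation.\<close>
  let ?P = "four_block_mat P ?Z ?Z P" and ?Q = "four_block_mat Q ?Z ?Z Q"
  let ?A = "four_block_mat C ?I ?I D" and ?B = "four_block_mat C' ?I ?I D'"
  note mult = mult_four_block_mat[where ?nr1.0 = n and ?n1.0 = n and ?n2.0 = n and ?nr2.0 = n
      and ?nc1.0 = n and ?nc2.0 = n]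
  have I: "four_block_mat ?I ?Z ?Z ?I = 1\<^sub>m (n + n)" by (rule eq_matI) auto
  have cP: "?P \<in> carrier_mat (n + n) (n + n)" and cQ: "?Q \<in> carrier_mat (n + n) (n + n)"
    and cA: "?A \<in> carrier_mat (n + n) (n + n)" and cB: "?B \<in> carrier_mat (n + n) (n + n)"
    using carrier by auto
  have PQ': "?P * ?Q = 1\<^sub>m (n + n)"
    using carrier PQ by (subst mult) (auto simp: I)
  have QP': "?Q * ?P = 1\<^sub>m (n + n)"
    using carrier QP by (subst mult) (auto simp: I)
  have "?A * ?P = ?P * ?B"
    using carrier C D by (subst (1 2) mult) auto
  then have "?P * ?B * ?Q = ?A * (?P * ?Q)"
    using assoc_mult_mat[OF cA cP cQ] by simp
  then have "?A = ?P * ?B * ?Q"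
    using PQ' right_mult_one_mat[OF cA] by simp
  then show ?thesis
    using cP cQ cA cB PQ' QP' by (intro similar_matI[of _ _ ?P ?Q "n + n"]) auto
qed

lemma det_mat_diag: "det (mat_diag n f) = (\<Prod>j<n. f j)"
proof -
  have "det (mat_diag n f) = prod_list (diag_mat (mat_diag n f))"
    by (rule det_upper_triangular[of _ n]) (auto simp: mat_diag_def)
  also have "\<dots> = (\<Prod>j<n. f j)"
    by (simp add: prod_list_diag_prod mat_diag_def atLeast0LessThan)
  finally show ?thesis .
qed

text \<open>All blocks of the characteristic matrix are diagonal and hence commute, so its
  determinant is that of a single diagonal matrix over the polynomial ring. The product of the two
  off-diagonal entries -1 accounts for the subtracted 1.\<close>

lemma char_poly_four_block_diag:
  fixes c d :: "nat \<Rightarrow> 'a :: idom"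
  shows "char_poly (four_block_mat (mat_diag n c) (1\<^sub>m n) (1\<^sub>m n) (mat_diag n d)) =
    (\<Prod>j<n. [:- c j, 1:] * [:- d j, 1:] - 1)"
proof -
  let ?C = "mat_diag n (\<lambda>j. [:- c j, 1:])" and ?D = "mat_diag n (\<lambda>j. [:- d j, 1:])"
    and ?I = "mat_diag n (\<lambda>j. - 1 :: 'a poly)"
  have "char_poly_matrix (four_block_mat (mat_diag n c) (1\<^sub>m n) (1\<^sub>m n) (mat_diag n d)) =
      four_block_mat ?C ?I ?I ?D"
    by (rule eq_matI) (auto simp: char_poly_matrix_def mat_diag_def one_pCons)
  moreover have "det (four_block_mat ?C ?I ?I ?D) = det (?C * ?D - ?I * ?I)"
    by (rule det_four_block_mat[where n = n]) (auto simp: mult.commute)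
  moreover have "?C * ?D - ?I * ?I = mat_diag n (\<lambda>j. [:- c j, 1:] * [:- d j, 1:] - 1)"
    unfolding mat_diag_diag by (rule eq_matI) (auto simp: mat_diag_def)
  ultimately show ?thesis
    by (simp only: char_poly_def det_mat_diag)
qed

text \<open>The Fourier matrix forces a detour through the complex numbers. The resulting factors
  have real coefficients, so injectivity of the embedding on polynomials brings the identity back to
  the reals.\<close>

lemma char_poly_gp_adj_mat:
  assumes "3 \<le> n" "1 \<le> k" "2 * k \<le> n"
  shows "char_poly (gp_adj_mat n k) =
    (\<Prod>j<n. [:- (2 * cos (2 * pi * real j / real n)), 1:] *
            [:- (2 * cos (2 * pi * real (k * j) / real n)), 1:] - 1)"
    (is "_ = ?p")
proof -
  let ?h = "of_real :: real \<Rightarrow> complex"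
  let ?c = "\<lambda>s j. 2 * cos (2 * pi * real (s * j) / real n)"
  interpret h: map_poly_inj_idom_hom ?h ..
  have "map_poly ?h (char_poly (gp_adj_mat n k)) = char_poly (map_mat ?h (gp_adj_mat n k))"
    by (rule of_real_hom.char_poly_hom[symmetric, of _ "2 * n"]) (simp add: gp_adj_mat_def)
  also have "\<dots> = char_poly (four_block_mat (circulant n 1) (1\<^sub>m n) (1\<^sub>m n) (circulant n k))"
    using assms by (simp only: gp_adj_mat_four_block)
  also have "\<dots> = char_poly (four_block_mat (mat_diag n (\<lambda>j. ?h (?c 1 j))) (1\<^sub>m n) (1\<^sub>m n)
      (mat_diag n (\<lambda>j. ?h (?c k j))))"
    using assms
    by (intro char_poly_similar similar_four_block_conjugate[where P = "dft_mat n" and Q = "idft_mat n"]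
        circulant_mult_dft_mat dft_mat_inverse) simp_all
  also have "\<dots> = (\<Prod>j<n. [:- ?h (?c 1 j), 1:] * [:- ?h (?c k j), 1:] - 1)"
    by (rule char_poly_four_block_diag)
  also have "\<dots> = map_poly ?h ?p"
    by (simp add: h.hom_prod h.hom_mult h.hom_minus)
  finally show ?thesis
    by (rule h.injectivity)
qed

section \<open>Counting large eigenvalues through linear factors\<close>

lemma card_roots_le_sum_order:
  fixes p :: "'a :: {idom, linorder} poly"
  assumes p: "p \<noteq> 0" and J: "finite J" and dvd: "(\<Prod>j\<in>J. [:- r j, 1:]) dvd p"
    and ge: "\<And>j. j \<in> J \<Longrightarrow> t \<le> r j"
  shows "card J \<le> (\<Sum>x | poly p x = 0 \<and> t \<le> x. order x p)"
proof -
  let ?R = "{x. poly p x = 0 \<and> t \<le> x}"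
  have R: "finite ?R" using poly_roots_finite[OF p] by (rule rev_finite_subset) auto
  have root: "r j \<in> ?R" if "j \<in> J" for j
  proof -
    have "[:- r j, 1:] dvd p" using dvd_prodI[OF J that] dvd by (rule dvd_trans)
    then show ?thesis using ge[OF that] by (simp add: poly_eq_0_iff_dvd)
  qed
  \<comment> \<open>\<open>J\<close> is split into the fibres of \<open>r\<close>. The fibre over
    \<open>x\<close> contributes a power of the linear factor at \<open>x\<close> that divides
    \<open>p\<close>, so its size is at most the order of \<open>x\<close>.\<close>
  have "card J = card (\<Union>x\<in>?R. {j \<in> J. r j = x})"
    using root by (intro arg_cong[where f = card]) auto
  also have "\<dots> \<le> (\<Sum>x\<in>?R. card {j \<in> J. r j = x})"
    by (rule card_UN_le[OF R])
  also have "\<dots> \<le> (\<Sum>x\<in>?R. order x p)"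
  proof (rule sum_mono)
    fix x
    have "[:- x, 1:] ^ card {j \<in> J. r j = x} = (\<Prod>j\<in>{j \<in> J. r j = x}. [:- r j, 1:])"
      by simp
    also have "\<dots> dvd (\<Prod>j\<in>J. [:- r j, 1:])"
      by (rule prod_dvd_prod_subset) (use J in auto)
    finally show "card {j \<in> J. r j = x} \<le> order x p"
      using dvd p by (meson dvd_trans order_divides)
  qed
  finally show ?thesis .
qed

text \<open>The quadratic is the characteristic polynomial of the matrix with diagonal
  \<open>2 * a\<close>, \<open>2 * b\<close> and off-diagonal entries 1. Its larger root is
  \<open>a + b + sqrt ((a - b)^2 + 1)\<close>, and this square root is at least 1.\<close>

lemma quadratic_factor_ge:
  fixes a b :: real
  shows "\<exists>r \<ge> a + b + 1. [:- r, 1:] dvd [:- (2 * a), 1:] * [:- (2 * b), 1:] - 1"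
proof -
  define w where "w = sqrt ((a - b)\<^sup>2 + 1)"
  have w2: "w\<^sup>2 = (a - b)\<^sup>2 + 1" by (simp add: w_def)
  have "w \<ge> 1" by (simp add: w_def)
  moreover have "poly ([:- (2 * a), 1:] * [:- (2 * b), 1:] - 1) (a + b + w) = w\<^sup>2 - (a - b)\<^sup>2 - 1"
    by (simp add: power2_eq_square algebra_simps)
  then have "[:- (a + b + w), 1:] dvd [:- (2 * a), 1:] * [:- (2 * b), 1:] - 1"
    using w2 by (simp only: poly_eq_0_iff_dvd[symmetric])
  ultimately show ?thesis by (intro exI[of _ "a + b + w"]) auto
qed

text \<open>Reduces the spectral bound to a count of angles: each index in \<open>J\<close> supplies
  one root of its own quadratic factor, and roots that coincide for several indices are counted by
  multiplicity.\<close>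

lemma card_le_num_eigenvalues_ge:
  assumes nk: "3 \<le> n" "1 \<le> k" "2 * k \<le> n" and J: "J \<subseteq> {..<n}"
    and ge: "\<And>j. j \<in> J \<Longrightarrow>
      t \<le> cos (2 * pi * real j / real n) + cos (2 * pi * real (k * j) / real n) + 1"
  shows "card J \<le> num_eigenvalues_ge (gp_adj_mat n k) t"
proof -
  let ?a = "\<lambda>j. cos (2 * pi * real j / real n)" and ?b = "\<lambda>j. cos (2 * pi * real (k * j) / real n)"
  let ?q = "\<lambda>j. [:- (2 * ?a j), 1:] * [:- (2 * ?b j), 1:] - 1"
  let ?A = "gp_adj_mat n k"
  have A: "?A \<in> carrier_mat (2 * n) (2 * n)" by (simp add: gp_adj_mat_def)
  have fin: "finite J" using J by (rule finite_subset) simp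
  have "\<forall>j. \<exists>r \<ge> ?a j + ?b j + 1. [:- r, 1:] dvd ?q j"
    by (intro allI quadratic_factor_ge)
  then obtain r where r: "\<And>j. r j \<ge> ?a j + ?b j + 1" "\<And>j. [:- r j, 1:] dvd ?q j"
    by metis
  have "(\<Prod>j\<in>J. [:- r j, 1:]) dvd (\<Prod>j\<in>J. ?q j)"
    by (rule prod_dvd_prod) (rule r)
  also have "\<dots> dvd (\<Prod>j<n. ?q j)"
    by (rule prod_dvd_prod_subset) (use J in auto)
  also have "\<dots> = char_poly ?A"
    using nk by (rule char_poly_gp_adj_mat[symmetric])
  finally have "(\<Prod>j\<in>J. [:- r j, 1:]) dvd char_poly ?A" .
  moreover have "char_poly ?A \<noteq> 0"
    using degree_monic_char_poly[OF A] by auto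
  moreover have "t \<le> r j" if "j \<in> J" for j
    using r(1)[of j] ge[OF that] by linarith
  ultimately have "card J \<le> (\<Sum>x | poly (char_poly ?A) x = 0 \<and> t \<le> x. order x (char_poly ?A))"
    using fin by (intro card_roots_le_sum_order) auto
  then show ?thesis
    by (simp add: num_eigenvalues_ge_def eigenvalue_root_char_poly[OF A])
qed

section \<open>Pigeonhole principle for pairs of angles\<close>

lemma cos_ge_quadratic: "1 - x\<^sup>2 / 2 \<le> cos (x :: real)"
proof -
  have "(sin (x / 2))\<^sup>2 \<le> (x / 2)\<^sup>2"
    by (subst abs_le_square_iff[symmetric]) (rule abs_sin_x_le_abs_x)
  moreover have "cos x = 1 - 2 * (sin (x / 2))\<^sup>2"
    using cos_double_sin[of "x / 2"] by simp
  ultimately show ?thesis by (simp add: power_divide)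
qed

text \<open>With common quotient \<open>q\<close>, both \<open>m * x\<close> and
  \<open>m * y\<close> lie in the half-open interval from \<open>q * n\<close> to
  \<open>(q + 1) * n\<close>.\<close>

lemma abs_diff_less_of_div_eq:
  fixes x y m n :: nat
  assumes "0 < n" "m * x div n = m * y div n"
  shows "real m * \<bar>real x - real y\<bar> < real n"
proof -
  let ?q = "m * x div n"
  have "m * x = ?q * n + m * x mod n" "m * y = ?q * n + m * y mod n"
    using assms(2) by (metis div_mult_mod_eq)+
  moreover have "m * x mod n < n" "m * y mod n < n" using assms(1) by simp_all
  ultimately have "m * x < m * y + n" "m * y < m * x + n" by linarith+
  then have "real (m * x) < real (m * y + n)" "real (m * y) < real (m * x + n)"
    by (simp_all only: of_nat_less_iff)
  then show ?thesis by (simp add: abs_if right_diff_distrib)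
qed

text \<open>The fractional parts of \<open>x / n\<close> and \<open>y / n\<close> share a cell of
  length \<open>1 / m\<close>, so the angle is within \<open>2 * pi / m\<close> of a multiple of
  \<open>2 * pi\<close>; the quadratic bound on the cosine then applies.\<close>

lemma cos_ge_if_close_mod:
  fixes x y m n :: nat
  assumes "0 < m" "0 < n" "y \<le> x" "m * (x mod n) div n = m * (y mod n) div n"
  shows "1 - 2 * pi\<^sup>2 / (real m)\<^sup>2 \<le> cos (2 * pi * real (x - y) / real n)"
proof -
  \<comment> \<open>The difference of the fractional parts, which differs from
    \<open>(x - y) / n\<close> by an integer.\<close>
  define u where "u = (real (x mod n) - real (y mod n)) / real n"
  have "real x = real (x mod n) + real n * real (x div n)"
    "real y = real (y mod n) + real n * real (y div n)"
    by (simp_all flip: of_nat_mult of_nat_add)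
  then have "real (x - y) / real n = u + of_int (int (x div n) - int (y div n))"
    using assms by (simp add: u_def of_nat_diff field_simps)
  then have "2 * pi * real (x - y) / real n = 2 * pi * u + 2 * pi * of_int (int (x div n) - int (y div n))"
    by (metis distrib_left times_divide_eq_right)
  then have cos: "cos (2 * pi * real (x - y) / real n) = cos (2 * pi * u)"
    by (simp only: cos_add cos_int_2pin sin_int_2pin)
  have "real m * \<bar>u\<bar> < 1"
    using abs_diff_less_of_div_eq[OF assms(2,4)] assms(2) by (simp add: u_def field_simps)
  then have "\<bar>u\<bar> \<le> 1 / real m" using assms(1) by (simp add: field_simps)
  then have "\<bar>u\<bar>\<^sup>2 \<le> (1 / real m)\<^sup>2" by (intro power_mono) auto
  then have "2 * pi\<^sup>2 * u\<^sup>2 \<le> 2 * pi\<^sup>2 * (1 / (real m)\<^sup>2)"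
    by (intro mult_left_mono) (auto simp: power_divide)
  moreover have "1 - 2 * pi\<^sup>2 * u\<^sup>2 \<le> cos (2 * pi * u)"
    using cos_ge_quadratic[of "2 * pi * u"] by (simp add: power_mult_distrib)
  ultimately show ?thesis using cos by simp
qed

text \<open>Subtracting the least index of a popular cell keeps the differences in \<open>{..<n}\<close>.\<close>

lemma many_simultaneously_small_angles:
  fixes m n k :: nat
  assumes m: "0 < m" and n: "0 < n"
  shows "\<exists>J \<subseteq> {..<n}. n \<le> card J * m\<^sup>2 \<and>
    (\<forall>j\<in>J. 1 - 2 * pi\<^sup>2 / (real m)\<^sup>2 \<le> cos (2 * pi * real j / real n) \<and>
           1 - 2 * pi\<^sup>2 / (real m)\<^sup>2 \<le> cos (2 * pi * real (k * j) / real n))"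
proof -
  \<comment> \<open>\<open>f j\<close> names the cell of the \<open>m\<close> by \<open>m\<close>
    grid on the torus that contains the fractional parts of \<open>j / n\<close> and
    \<open>k * j / n\<close>.\<close>
  define f where "f j = (m * (j mod n) div n, m * (k * j mod n) div n)" for j
  have cell: "m * (x mod n) div n < m" for x
    using m n by (intro less_mult_imp_div_less mult_strict_left_mono) simp_all
  have "\<exists>y\<in>{..<m} \<times> {..<m}. card (f -` {y} \<inter> {..<n}) * card ({..<m} \<times> {..<m}) \<ge> card {..<n}"
    using m by (intro pigeonhole_card) (auto simp: f_def cell simp del: mod_less)
  then obtain y where y: "n \<le> card (f -` {y} \<inter> {..<n}) * m\<^sup>2"
    by (auto simp: card_cartesian_product power2_eq_square)
  define S where "S = f -` {y} \<inter> {..<n}"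
  have fin: "finite S" by (simp add: S_def)
  have "S \<noteq> {}" using y n by (auto simp: S_def)
  define i where "i = Min S"
  have iS: "i \<in> S" and le: "\<And>j. j \<in> S \<Longrightarrow> i \<le> j"
    using fin \<open>S \<noteq> {}\<close> by (auto simp: i_def)
  let ?J = "(\<lambda>j. j - i) ` S"
  have "inj_on (\<lambda>j. j - i) S"
    using le by (auto simp: inj_on_def dest: eq_diff_iff[THEN iffD1, rotated 2])
  then have card: "card ?J = card S" by (rule card_image)
  have "1 - 2 * pi\<^sup>2 / (real m)\<^sup>2 \<le> cos (2 * pi * real (j - i) / real n) \<and>
      1 - 2 * pi\<^sup>2 / (real m)\<^sup>2 \<le> cos (2 * pi * real (k * (j - i)) / real n)" if j: "j \<in> S" for j
  proof -
    have "f j = f i" using j iS by (simp add: S_def)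
    \<comment> \<open>Equality of the first components controls the angle of \<open>j - i\<close>;
      equality of the second controls that of \<open>k * j - k * i\<close>, which is
      \<open>k * (j - i)\<close>.\<close>
    then show ?thesis
      using cos_ge_if_close_mod[OF m n, of i j] cos_ge_if_close_mod[OF m n, of "k * i" "k * j"] le[OF j]
      by (simp add: f_def diff_mult_distrib2)
  qed
  then show ?thesis
    using y card by (intro exI[of _ ?J]) (auto simp: S_def)
qed

theorem theorem1p4:
  fixes \<epsilon> :: real
  assumes "\<epsilon> > 0"
  shows "\<exists>C>0. \<forall>n k :: nat. 3 \<le> n \<and> 1 \<le> k \<and> 2 * k \<le> n \<longrightarrow>
           real (num_eigenvalues_ge (gp_adj_mat n k) (3 - \<epsilon>)) \<ge> C * real (2 * n)"
proof -
  \<comment> \<open>Each of the two cosines loses at most \<open>2 * pi^2 / m^2\<close>, so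
    \<open>4 * pi^2 / m^2\<close> must not exceed \<epsilon>. The summand 1 ensures that
    \<open>m\<close> is at least 1, whence \<open>m\<close> is at most \<open>m^2\<close> and a
    linear bound on \<open>m\<close> suffices.\<close>
  obtain m :: nat where m: "4 * pi\<^sup>2 / \<epsilon> + 1 \<le> real m" using real_arch_simple by blast
  have "0 < 4 * pi\<^sup>2 / \<epsilon>" using assms by simp
  then have m1: "1 \<le> real m" using m by linarith
  then have m0: "0 < m" by simp
  have "real m \<le> (real m)\<^sup>2" using m1 by (simp add: power2_eq_square)
  then have "4 * pi\<^sup>2 / \<epsilon> \<le> (real m)\<^sup>2" using m by linarith
  then have eps: "4 * pi\<^sup>2 / (real m)\<^sup>2 \<le> \<epsilon>" using assms m0 by (simp add: field_simps)
  show ?thesis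
  \<comment> \<open>The popular cell yields at least \<open>n / m^2\<close> indices, which is this
    constant times \<open>2 * n\<close>; \<open>m\<close> was chosen from \<epsilon> alone.\<close>
  proof (intro exI[of _ "1 / (2 * (real m)\<^sup>2)"] conjI allI impI)
    show "0 < 1 / (2 * (real m)\<^sup>2)" using m0 by simp
  next
    fix n k :: nat
    assume nk: "3 \<le> n \<and> 1 \<le> k \<and> 2 * k \<le> n"
    then have "0 < n" by simp
    then obtain J where J: "J \<subseteq> {..<n}" "n \<le> card J * m\<^sup>2"
      and cos: "\<And>j. j \<in> J \<Longrightarrow> 1 - 2 * pi\<^sup>2 / (real m)\<^sup>2 \<le> cos (2 * pi * real j / real n)"
        "\<And>j. j \<in> J \<Longrightarrow> 1 - 2 * pi\<^sup>2 / (real m)\<^sup>2 \<le> cos (2 * pi * real (k * j) / real n)"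
      using many_simultaneously_small_angles[OF m0, of n k] by metis
    have "card J \<le> num_eigenvalues_ge (gp_adj_mat n k) (3 - \<epsilon>)"
    proof (rule card_le_num_eigenvalues_ge)
      fix j assume "j \<in> J"
      then show "3 - \<epsilon> \<le> cos (2 * pi * real j / real n) + cos (2 * pi * real (k * j) / real n) + 1"
        using cos[of j] eps by simp
    qed (use nk J in auto)
    moreover have "real n \<le> real (card J) * (real m)\<^sup>2"
      using J(2) by (metis of_nat_le_iff of_nat_mult of_nat_power)
    then have "1 / (2 * (real m)\<^sup>2) * real (2 * n) \<le> real (card J)"
      using m0 by (simp add: field_simps)
    ultimately show "1 / (2 * (real m)\<^sup>2) * real (2 * n) \<le>
        real (num_eigenvalues_ge (gp_adj_mat n k) (3 - \<epsilon>))"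
      by linarith
  qed
qed

end
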